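(* Let $k,a$ be positive integers and let $(G_{k,n})_{n\ge 0}$ be the Generalized $k$-Pell sequence with $G_{k,0}=G_{k,1}=a$. Set $r_1=1+\sqrt{1+k}$ and $r_2=1-\sqrt{1+k}$. Then for every integer $n\ge 0$, \[G_{k,n}=\frac{a r_1^n+a r_2^n}{2}=\frac{a(1+\sqrt{1+k})^n+a(1-\sqrt{1+k})^n}{2}.\]
   Context: For positive integers $k,a$, the Generalized $k$-Pell sequence $(G_{k,n})_{n\ge 0}$ is the integer sequence defined by $G_{k,0}=G_{k,1}=a$ and $G_{k,n}=2G_{k,n-1}+kG_{k,n-2}$ for $n\ge 2$. *)

theory Defs
  imports Complex_Main
begin

fun gen_pell :: "int \<Rightarrow> int \<Rightarrow> nat \<Rightarrow> int" where
  "gen_pell k a 0 = a"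
| "gen_pell k a (Suc 0) = a"
| "gen_pell k a (Suc (Suc n)) = 2 * gen_pell k a (Suc n) + k * gen_pell k a n"

end

theory Submission
  imports Defs
begin

text \<open>
  The numbers \<open>1 \<plusminus> sqrt (1 + k)\<close> are the roots of \<open>x\<^sup>2 = 2 * x + k\<close>, the characteristic
  equation of the recurrence. Hence the powers of each root, and all linear combinations of
  them, satisfy the recurrence. The combination with both coefficients \<open>a / 2\<close> takes the value
  \<open>a\<close> at index 0, and also at index 1 because the roots sum to 2; a second-order recurrence is
  determined by these two values.
\<close>

text \<open>
  The hypothesis \<open>x + y = 2\<close> does not follow from the other two: it rules out \<open>x\<close> and \<open>y\<close>
  being the same one of two distinct roots, when the right-hand side at index 1 would be \<open>a * x\<close>
  with \<open>x \<noteq> 1\<close>.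
\<close>
lemma gen_pell_eq_char_root_powers:
  fixes x y :: real
  assumes "x\<^sup>2 = 2 * x + real_of_int k" and "y\<^sup>2 = 2 * y + real_of_int k"
    and "x + y = 2"
  shows "real_of_int (gen_pell k a n) = (real_of_int a * x ^ n + real_of_int a * y ^ n) / 2"
  using assms
proof (induction k a n rule: gen_pell.induct)
  case (1 k a)
  then show ?case by simp
next
  case (2 k a)
  then have "real_of_int a * x + real_of_int a * y = real_of_int a * 2"
    by (simp flip: distrib_left)
  then show ?case by simp
next
  case (3 k a n)
  have step: "z ^ Suc (Suc n) = 2 * z ^ Suc n + real_of_int k * z ^ n"
    if "z\<^sup>2 = 2 * z + real_of_int k" for z :: real
  proof -
    have "z ^ Suc (Suc n) = z\<^sup>2 * z ^ n"
      by (simp add: power2_eq_square)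
    also have "\<dots> = 2 * z ^ Suc n + real_of_int k * z ^ n"
      unfolding that by (simp add: algebra_simps)
    finally show ?thesis .
  qed
  show ?case
    unfolding gen_pell.simps step[OF 3(3)] step[OF 3(4)]
    using 3 by (simp add: field_simps)
qed

theorem theorem2p1:
  fixes k a :: int and r1 r2 :: real and n :: nat
  assumes "k > 0" and "a > 0"
    and "r1 = 1 + sqrt (1 + real_of_int k)"
    and "r2 = 1 - sqrt (1 + real_of_int k)"
  shows "real_of_int (gen_pell k a n) = (real_of_int a * r1 ^ n + real_of_int a * r2 ^ n) / 2
    \<and> (real_of_int a * r1 ^ n + real_of_int a * r2 ^ n) / 2
        = (real_of_int a * (1 + sqrt (1 + real_of_int k)) ^ n
           + real_of_int a * (1 - sqrt (1 + real_of_int k)) ^ n) / 2"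
proof -
  have sq: "(sqrt (1 + real_of_int k))\<^sup>2 = 1 + real_of_int k"
    using assms(1) by simp
  have "r1\<^sup>2 = 2 * r1 + real_of_int k" and "r2\<^sup>2 = 2 * r2 + real_of_int k"
    unfolding assms(3,4) power2_sum power2_diff sq by simp_all
  moreover have "r1 + r2 = 2"
    by (simp add: assms(3,4))
  ultimately show ?thesis
    using gen_pell_eq_char_root_powers assms(3,4) by simp
qed

end
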